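(* Let $Y=\sum_{k=1}^{D/T} y_k$ be the number of service composition solutions used by the schedule produced by the greedy algorithm (described in the context). Then $Y$ is optimal: $Y$ equals the minimum, over all feasible schedules of service composition solutions for the persistent query, of the number $\sum_{k=1}^{D/T} y_k$ of service composition solutions used.
   Context: Setting. A persistent query requires a sequence of services $S=\{s_1\to\cdots\to s_m\}$. There are service providers $P=\{p_1,\dots,p_n\}$, and $P_j\subseteq P$ denotes the set of providers that can provide service $s_j$ (a provider may provide several services). The query has duration $D$ and frequency (period) $T$ with $D/T$ a positive integer, so it is executed $D/T$ times, at times $t_1,\dots,t_{D/T}$. Let $x_{ik}\in\{0,1\}$, with $x_{ik}=1$ if provider $p_i$ is active (available) at $t_k$ and $x_{ik}=0$ otherwise. These data are given. It is assumed that for every execution $k$ and every service $s_j$ there is at least one $p_i\in P_j$ with $x_{ik}=1$. Service composition solutions and schedules. A service composition solution assigns to each service $s_j$ ($1\le j\le m$) a provider in $P_j$. It is valid at $t_k$ if all the assigned providers are active at $t_k$. A feasible schedule chooses, for each $k=1,\dots,D/T$, a service composition solution valid at $t_k$. For a feasible schedule, $y_1=1$, and for $k\ge 2$, $y_k=1$ if the solution chosen at $t_k$ differs from the solution chosen at $t_{k-1}$, and $y_k=0$ otherwise. The number of service composition solutions used by the schedule is $\sum_{k=1}^{D/T}y_k$. Greedy algorithm. Let $avl_{ik}$ be the number of consecutive executions, starting from and including the $k$-th, at which $p_i$ is available, i.e. the largest integer $a\ge 0$ such that $k+a-1\le D/T$ and $x_{ik}=x_{i,k+1}=\cdots=x_{i,k+a-1}=1$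 (with $a=0$ if $x_{ik}=0$). Start with $k=1$, $h=1$ and all $y_k=0$. While $k\le D/T$: for each service $s_j$ select a provider in $P_j$ maximizing $avl_{ik}$ over $p_i\in P_j$ (ties broken arbitrarily), and let $SC_k$ be the set of selected providers; set $num_h=\min_{p_i\in SC_k} avl_{ik}$; use the selected service composition solution for the executions $k,k+1,\dots,k+num_h-1$; set $y_k=1$; then replace $k$ by $k+num_h$ and $h$ by $h+1$. The values $y_k$ produced by the algorithm define $Y=\sum_{k=1}^{D/T}y_k$. *)

theory Defs
  imports Complex_Main "HOL-Library.FuncSet" "HOL-Library.While_Combinator"
begin

text \<open>
  Services are referred to by their position \<open>j \<in> {1..m}\<close> in the sequence
  \<open>s\<^sub>1 \<rightarrow> \<dots> \<rightarrow> s\<^sub>m\<close>, executions by their index \<open>k \<in> {1..D/T}\<close>;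
  \<open>provs q j\<close> is \<open>P\<^sub>j\<close> and \<open>active q p k\<close> is the availability indicator \<open>x\<^sub>i\<^sub>k\<close>
  of the provider \<open>p = p\<^sub>i\<close>.
\<close>

record 'p query =
  providers :: "'p set"
  num_services :: nat
  provs :: "nat \<Rightarrow> 'p set"
  duration :: real
  period :: real
  active :: "'p \<Rightarrow> nat \<Rightarrow> nat"

definition services :: "'p query \<Rightarrow> nat set" where
  "services q = {1..num_services q}"

definition num_exec :: "'p query \<Rightarrow> nat" where
  "num_exec q = nat \<lfloor>duration q / period q\<rfloor>"

definition persistent_query :: "'p query \<Rightarrow> bool" where
  "persistent_query q \<longleftrightarrow>
     finite (providers q) \<and>
     num_services q \<ge> 1 \<and>
     (\<forall>j\<in>services q. provs q j \<subseteq> providers q) \<and>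
     period q > 0 \<and>
     (\<exists>N::nat. N \<ge> 1 \<and> duration q / period q = real N) \<and>
     (\<forall>p\<in>providers q. \<forall>k\<in>{1..num_exec q}. active q p k \<in> {0, 1}) \<and>
     (\<forall>k\<in>{1..num_exec q}. \<forall>j\<in>services q. \<exists>p\<in>provs q j. active q p k = 1)"

text \<open>
  Solutions and schedules are extensional functions, so that equality of functions
  is equality of solutions.
\<close>

type_synonym 'p solution = "nat \<Rightarrow> 'p"
type_synonym 'p schedule = "nat \<Rightarrow> 'p solution"

definition solutions :: "'p query \<Rightarrow> 'p solution set" where
  "solutions q = (\<Pi>\<^sub>E j\<in>services q. provs q j)"

definition valid_at :: "'p query \<Rightarrow> nat \<Rightarrow> 'p solution \<Rightarrow> bool" where
  "valid_at q k c \<longleftrightarrow> (\<forall>j\<in>services q. active q (c j) k = 1)"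

definition feasible_schedules :: "'p query \<Rightarrow> 'p schedule set" where
  "feasible_schedules q = (\<Pi>\<^sub>E k\<in>{1..num_exec q}. {c \<in> solutions q. valid_at q k c})"

definition new_solution :: "'p schedule \<Rightarrow> nat \<Rightarrow> nat" where
  "new_solution \<sigma> k = (if k = 1 \<or> \<sigma> k \<noteq> \<sigma> (k - 1) then 1 else 0)"

definition solutions_used :: "'p query \<Rightarrow> 'p schedule \<Rightarrow> nat" where
  "solutions_used q \<sigma> = (\<Sum>k=1..num_exec q. new_solution \<sigma> k)"

definition avl :: "'p query \<Rightarrow> 'p \<Rightarrow> nat \<Rightarrow> nat" where
  "avl q p k = (GREATEST a. k + a \<le> num_exec q + 1 \<and> (\<forall>l\<in>{k..<k + a}. active q p l = 1))"

record 'p greedy_state =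
  pos :: nat                        \<comment> \<open>\<open>k\<close>\<close>
  stage :: nat                      \<comment> \<open>\<open>h\<close>\<close>
  num :: "nat \<Rightarrow> nat"               \<comment> \<open>\<open>num\<^sub>h\<close>\<close>
  yval :: "nat \<Rightarrow> nat"              \<comment> \<open>\<open>y\<^sub>k\<close>\<close>
  sched :: "'p schedule"            \<comment> \<open>the part of the schedule fixed so far\<close>

definition greedy_init :: "'p greedy_state" where
  "greedy_init = \<lparr>pos = 1, stage = 1, num = (\<lambda>_. 0), yval = (\<lambda>_. 0), sched = (\<lambda>_. undefined)\<rparr>"

definition greedy_step :: "'p query \<Rightarrow> 'p solution \<Rightarrow> 'p greedy_state \<Rightarrow> 'p greedy_state" where
  "greedy_step q c st =
     (let k = pos st; h = stage st;
          SC = c ` services q;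
          n = Min ((\<lambda>p. avl q p k) ` SC)
      in \<lparr>pos = k + n, stage = h + 1, num = (num st)(h := n), yval = (yval st)(k := 1),
          sched = (\<lambda>l. if l \<in> {k..<k + n} then c else sched st l)\<rparr>)"

text \<open>
  A selection rule resolves the ties; it may depend on the whole state reached so far.
\<close>

definition greedy_selection :: "'p query \<Rightarrow> ('p greedy_state \<Rightarrow> 'p solution) \<Rightarrow> bool" where
  "greedy_selection q sel \<longleftrightarrow>
     (\<forall>st. pos st \<in> {1..num_exec q} \<longrightarrow>
        sel st \<in> solutions q \<and>
        (\<forall>j\<in>services q. is_arg_max (\<lambda>p. avl q p (pos st)) (\<lambda>p. p \<in> provs q j) (sel st j)))"

text \<open>The result is \<^term>\<open>None\<close> exactly if the loop does not terminate.\<close>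

definition greedy ::
  "'p query \<Rightarrow> ('p greedy_state \<Rightarrow> 'p solution) \<Rightarrow> 'p greedy_state option" where
  "greedy q sel =
     while_option (\<lambda>st. pos st \<le> num_exec q) (\<lambda>st. greedy_step q (sel st) st) greedy_init"

end

theory Submission imports Defs begin

text \<open>
  Greedy stays ahead: when the greedy algorithm switches at execution \<open>k\<close> after a block of length
  \<open>n\<close>, every provider of some service \<open>s\<^sub>j\<close> is inactive at some execution between the
  start of the block and \<open>k\<close>, so no feasible schedule can keep one solution from the start of
  the block up to \<open>k\<close>. Hence by execution \<open>k\<close> any feasible schedule has started at least as
  many solutions as the greedy one.
\<close>

lemma
  assumes "k \<le> num_exec q + 1"
  shows avl_le_num_exec: "k + avl q p k \<le> num_exec q + 1"
    and active_avl: "l \<in> {k..<k + avl q p k} \<Longrightarrow> active q p l = 1"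
proof -
  let ?P = "\<lambda>a. k + a \<le> num_exec q + 1 \<and> (\<forall>l\<in>{k..<k + a}. active q p l = 1)"
  \<comment> \<open>\<open>GREATEST\<close> is meaningful here because the candidates are bounded by
    \<open>num_exec q + 1\<close> and 0 is one of them; the latter is where the assumption on
    \<open>k\<close> enters.\<close>
  have "?P (avl q p k)"
    unfolding avl_def by (rule GreatestI_nat[of ?P 0 "num_exec q + 1"]) (use assms in auto)
  then show "k + avl q p k \<le> num_exec q + 1"
    and "l \<in> {k..<k + avl q p k} \<Longrightarrow> active q p l = 1"
    by auto
qed

lemma avl_ge:
  assumes "k + a \<le> num_exec q + 1" and "\<And>l. l \<in> {k..<k + a} \<Longrightarrow> active q p l = 1"
  shows "a \<le> avl q p k"
  unfolding avl_def by (rule Greatest_le_nat[where b = "num_exec q + 1"]) (use assms in auto)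

lemma num_exec_pos: "persistent_query q \<Longrightarrow> num_exec q \<ge> 1"
  by (auto simp: persistent_query_def num_exec_def)

text \<open>Makes \<open>Min\<close> in the final theorem a genuine minimum; nonemptiness will come
  from the greedy schedule itself.\<close>

lemma finite_feasible_schedules:
  assumes "persistent_query q"
  shows "finite (feasible_schedules q)"
proof -
  have "finite (solutions q)"
    unfolding solutions_def
  proof (rule finite_PiE)
    show "finite (provs q j)" if "j \<in> services q" for j
      using assms that by (meson finite_subset persistent_query_def)
  qed (simp add: services_def)
  then show ?thesis
    unfolding feasible_schedules_def by (intro finite_PiE) auto
qed

text \<open>The block length is set by a bottleneck service, and its selected provider lasts longest
  among all providers of that service. So they all fail by \<open>k + n\<close>; the closed interval
  includes the first execution after the block.\<close>

lemma greedy_block: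
  fixes c :: "'p solution"
  assumes q: "persistent_query q" and k: "k \<in> {1..num_exec q}"
    and max: "\<And>j. j \<in> services q \<Longrightarrow> is_arg_max (\<lambda>p. avl q p k) (\<lambda>p. p \<in> provs q j) (c j)"
  defines "n \<equiv> Min ((\<lambda>p. avl q p k) ` c ` services q)"
  shows "n \<ge> 1" and "k + n \<le> num_exec q + 1"
    and "\<And>l. l \<in> {k..<k + n} \<Longrightarrow> valid_at q l c"
    and "k + n \<le> num_exec q \<Longrightarrow>
      \<exists>j\<in>services q. \<forall>p\<in>provs q j. \<exists>l\<in>{k..k + n}. active q p l \<noteq> 1"
proof -
  have fin: "finite ((\<lambda>p. avl q p k) ` c ` services q)"
    and ne: "(\<lambda>p. avl q p k) ` c ` services q \<noteq> {}"
    using q by (auto simp: services_def persistent_query_def)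
  have le: "n \<le> avl q (c j) k" if "j \<in> services q" for j
    unfolding n_def using fin that by (intro Min_le) auto
  have avl_max: "avl q p k \<le> avl q (c j) k" if "j \<in> services q" "p \<in> provs q j" for j p
    using max[OF that(1)] that(2) by (force simp: is_arg_max_def)
  \<comment> \<open>The bottleneck service, at which the minimum \<open>n\<close> is
    attained.\<close>
  obtain j where j: "j \<in> services q" "n = avl q (c j) k"
    using Min_in[OF fin ne] unfolding n_def by auto
  obtain p where p: "p \<in> provs q j" "active q p k = 1"
    using q k j(1) unfolding persistent_query_def by blast
  have "1 \<le> avl q p k"
    by (rule avl_ge) (use k p in auto)
  also have "\<dots> \<le> n"
    using avl_max[OF j(1) p(1)] j(2) by simp
  finally show "n \<ge> 1" .
  show "k + n \<le> num_exec q + 1"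
    using avl_le_num_exec[of k q "c j"] k j(2) by simp
  show "valid_at q l c" if "l \<in> {k..<k + n}" for l
    unfolding valid_at_def
  proof
    fix i assume "i \<in> services q"
    then show "active q (c i) l = 1"
      using that k le[of i] by (intro active_avl[of k]) auto
  qed
  assume *: "k + n \<le> num_exec q"
  \<comment> \<open>A provider active on the whole closed interval would last \<open>Suc n\<close>
    executions, beating the maximum \<open>n\<close>. The assumption \<open>*\<close> keeps this
    longer run within the horizon.\<close>
  have "\<exists>l\<in>{k..k + n}. active q p l \<noteq> 1" if "p \<in> provs q j" for p
  proof (rule ccontr)
    assume "\<not> ?thesis"
    then have "Suc n \<le> avl q p k"
      by (intro avl_ge) (use * in auto)
    then show False
      using avl_max[OF j(1) that] j(2) by simp
  qed
  with j(1) show "\<exists>j\<in>services q. \<forall>p\<in>provs q j. \<exists>l\<in>{k..k + n}. active q p l \<noteq> 1"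
    by blast
qed

text \<open>The last conjunct is the comparison with an arbitrary schedule. Its extra 1 reserves the
  solution about to be started at \<open>pos st\<close> and vanishes on exit, when
  \<open>min\<close> truncates at the last execution. The invalidity conjunct forces the next choice
  to differ from the previous one, so that \<open>yval\<close> agrees with
  \<open>new_solution\<close>.\<close>

definition greedy_invariant :: "'p query \<Rightarrow> 'p greedy_state \<Rightarrow> bool" where
  "greedy_invariant q st \<longleftrightarrow>
     pos st \<in> {1..num_exec q + 1} \<and>
     (\<forall>l\<ge>pos st. yval st l = 0) \<and>
     (\<forall>l\<in>{1..<pos st}. sched st l \<in> solutions q \<and> valid_at q l (sched st l)) \<and>
     (\<forall>l. l \<notin> {1..<pos st} \<longrightarrow> sched st l = undefined) \<and>
     (\<forall>l\<in>{1..<pos st}. yval st l = new_solution (sched st) l) \<and>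
     (pos st \<in> {2..num_exec q} \<longrightarrow> \<not> valid_at q (pos st) (sched st (pos st - 1))) \<and>
     (\<forall>\<sigma>\<in>feasible_schedules q.
        (\<Sum>l=1..num_exec q. yval st l) + (if pos st \<le> num_exec q then 1 else 0)
          \<le> (\<Sum>l=1..min (pos st) (num_exec q). new_solution \<sigma> l))"

lemma constant_between_changes:
  assumes "\<And>l. l \<in> {k<..k'} \<Longrightarrow> new_solution \<sigma> l = 0" and "l \<in> {k..k'}"
  shows "\<sigma> l = \<sigma> k"
proof -
  have "k \<le> l" "l \<le> k'" using assms(2) by auto
  then show ?thesis
  proof (induction l rule: dec_induct)
    case (step l)
    then have "new_solution \<sigma> (Suc l) = 0" by (intro assms(1)) auto
    with step show ?case by (auto simp: new_solution_def split: if_splits)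
  qed simp
qed

text \<open>The reserved 1 is covered by \<open>new_solution \<sigma> 1 = 1\<close>, which holds for
  every schedule.\<close>

lemma greedy_invariant_init:
  assumes "persistent_query q"
  shows "greedy_invariant q greedy_init"
  using num_exec_pos[OF assms]
  by (auto simp: greedy_invariant_def greedy_init_def new_solution_def min_def)

lemma greedy_invariant_step:
  assumes q: "persistent_query q" and sel: "greedy_selection q sel"
    and inv: "greedy_invariant q st" and pos: "pos st \<le> num_exec q"
  shows "greedy_invariant q (greedy_step q (sel st) st)"
    and "pos st < pos (greedy_step q (sel st) st)"
proof -
  define k where "k = pos st"
  define c where "c = sel st"
  define n where "n = Min ((\<lambda>p. avl q p k) ` c ` services q)"
  define st' where "st' = greedy_step q (sel st) st"
  let ?N = "num_exec q"
  note inv' = inv[unfolded greedy_invariant_def, folded k_def]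
  have k: "k \<in> {1..?N}" using inv' pos by (auto simp: k_def)
  have c: "c \<in> solutions q"
    and max: "\<And>j. j \<in> services q \<Longrightarrow> is_arg_max (\<lambda>p. avl q p k) (\<lambda>p. p \<in> provs q j) (c j)"
    using sel k unfolding greedy_selection_def k_def c_def by blast+
  note block = greedy_block[OF q k max, folded n_def]
  have n: "n \<ge> 1" "k + n \<le> ?N + 1" by (rule block(1,2); assumption)+
  have valid: "valid_at q l c" if "l \<in> {k..<k + n}" for l using block(3) that by blast
  have blocked: "\<exists>j\<in>services q. \<forall>p\<in>provs q j. \<exists>l\<in>{k..k + n}. active q p l \<noteq> 1"
    if "k + n \<le> ?N" using block(4) that by blast
  have st': "pos st' = k + n" "yval st' = (yval st)(k := 1)"
    "sched st' = (\<lambda>l. if l \<in> {k..<k + n} then c else sched st l)"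
    by (simp_all add: st'_def greedy_step_def Let_def k_def c_def n_def cong: if_cong)
  show "pos st < pos (greedy_step q (sel st) st)"
    using n st' by (simp add: st'_def k_def)
  have yval_sum: "(\<Sum>l=1..?N. yval st' l) = (\<Sum>l=1..?N. yval st l) + 1"
  proof -
    have "(\<Sum>l\<in>{1..?N} - {k}. yval st' l) = (\<Sum>l\<in>{1..?N} - {k}. yval st l)"
      by (intro sum.cong) (auto simp: st')
    moreover have "yval st k = 0" "yval st' k = 1" using inv' by (auto simp: st')
    ultimately show ?thesis using k by (simp add: sum.remove[of _ k])
  qed
  have yval: "yval st' l = new_solution (sched st') l" if l: "l \<in> {1..<k + n}" for l
  proof -
    consider "l < k" | "l = k" | "k < l" by linarith
    then show ?thesis
    proof cases
      case 1
      then have "new_solution (sched st') l = new_solution (sched st) l"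
        by (auto simp: new_solution_def st')
      with 1 l inv' show ?thesis by (auto simp: st')
    next
      case 2
      \<comment> \<open>\<open>c\<close> is valid at \<open>k\<close>, whereas by the invariant the
        previous solution is not.\<close>
      have "c \<noteq> sched st (k - 1)" if "k \<noteq> 1"
        using that inv' k valid[of k] n by auto
      with 2 n k show ?thesis by (auto simp: new_solution_def st')
    next
      \<comment> \<open>Strictly inside the block both \<open>l - 1\<close> and \<open>l\<close> use
        \<open>c\<close>, and \<open>yval\<close> is still 0 there.\<close>
      case 3
      with l inv' show ?thesis by (auto simp: new_solution_def st')
    qed
  qed
  \<comment> \<open>Some provider chosen by \<open>c\<close> fails in the closed interval; validity
    of \<open>c\<close> throughout the block leaves only \<open>k + n\<close>.\<close>
  have ends: "\<not> valid_at q (k + n) c" if le: "k + n \<le> ?N"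
  proof
    assume last: "valid_at q (k + n) c"
    obtain j where j: "j \<in> services q" "\<And>p. p \<in> provs q j \<Longrightarrow> \<exists>l\<in>{k..k + n}. active q p l \<noteq> 1"
      using blocked[OF le] by blast
    have "c j \<in> provs q j" using c j(1) by (auto simp: solutions_def)
    then obtain l where l: "l \<in> {k..k + n}" "active q (c j) l \<noteq> 1" using j(2) by blast
    then have "valid_at q l c"
      using valid[of l] last by (cases "l = k + n") auto
    with l j(1) show False by (auto simp: valid_at_def)
  qed
  have ahead: "(\<Sum>l=1..?N. yval st' l) + (if k + n \<le> ?N then 1 else 0)
      \<le> (\<Sum>l=1..min (k + n) ?N. new_solution \<sigma> l)" if \<sigma>: "\<sigma> \<in> feasible_schedules q" for \<sigma>
  proof -
    have "(\<Sum>l=1..?N. yval st l) + (if k \<le> ?N then 1 else 0)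
        \<le> (\<Sum>l=1..min k ?N. new_solution \<sigma> l)"
      using inv' \<sigma> by blast
    \<comment> \<open>The 1 reserved in the invariant pays for setting \<open>yval\<close> to 1 at
      \<open>k\<close>.\<close>
    then have IH: "(\<Sum>l=1..?N. yval st' l) \<le> (\<Sum>l=1..k. new_solution \<sigma> l)"
      using k yval_sum by (simp add: min_def)
    have split: "(\<Sum>l=1..k'. new_solution \<sigma> l)
        = (\<Sum>l=1..k. new_solution \<sigma> l) + (\<Sum>l\<in>{k<..k'}. new_solution \<sigma> l)" if "k \<le> k'" for k'
      by (subst sum.union_disjoint[symmetric]) (use k that in \<open>auto intro!: sum.cong\<close>)
    show ?thesis
    proof (cases "k + n \<le> ?N")
      \<comment> \<open>The final block reserves nothing further, so it suffices that the sum for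
        \<sigma> does not decrease when extended from \<open>k\<close> to the last
        execution.\<close>
      case False
      then show ?thesis
        using IH split[of ?N] k by simp
    next
      case True
      \<comment> \<open>This change of \<sigma> pays for the next reserved 1. Without it \<sigma>
        would keep \<open>\<sigma> k\<close> up to \<open>k + n\<close>, although its provider for
        the bottleneck service fails on the way.\<close>
      have "(\<Sum>l\<in>{k<..k + n}. new_solution \<sigma> l) \<noteq> 0"
      proof
        assume "(\<Sum>l\<in>{k<..k + n}. new_solution \<sigma> l) = 0"
        then have "new_solution \<sigma> l = 0" if "l \<in> {k<..k + n}" for l using that by simp
        then have const: "\<sigma> l = \<sigma> k" if "l \<in> {k..k + n}" for l
          using constant_between_changes that by blast
        have feas: "\<sigma> l \<in> solutions q" "valid_at q l (\<sigma> l)" if "l \<in> {1..?N}" for l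
          using \<sigma> that by (auto simp: feasible_schedules_def)
        obtain j where j: "j \<in> services q"
          "\<And>p. p \<in> provs q j \<Longrightarrow> \<exists>l\<in>{k..k + n}. active q p l \<noteq> 1"
          using blocked[OF True] by blast
        have "\<sigma> k j \<in> provs q j" using feas(1)[OF k] j(1) by (auto simp: solutions_def)
        then obtain l where l: "l \<in> {k..k + n}" "active q (\<sigma> k j) l \<noteq> 1" using j(2) by blast
        have "l \<in> {1..?N}" using l(1) k True by auto
        then show False
          using feas(2)[of l] const[OF l(1)] l(2) j(1) by (auto simp: valid_at_def)
      qed
      then have "1 \<le> (\<Sum>l\<in>{k<..k + n}. new_solution \<sigma> l)" by linarith
      then show ?thesis
        using IH split[of "k + n"] True by (simp add: min_def del: sum_eq_0_iff)
    qed
  qed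
  have "greedy_invariant q st'"
    unfolding greedy_invariant_def st'(1)
  proof (intro conjI)
    show "\<forall>l\<in>{1..<k + n}. sched st' l \<in> solutions q \<and> valid_at q l (sched st' l)"
      using inv' c valid by (auto simp: st')
    show "\<forall>l. l \<notin> {1..<k + n} \<longrightarrow> sched st' l = undefined"
      using inv' k by (auto simp: st')
    show "k + n \<in> {2..?N} \<longrightarrow> \<not> valid_at q (k + n) (sched st' (k + n - 1))"
      using ends n by (auto simp: st')
  qed (use n k yval ahead inv' in \<open>auto simp: st'(2)\<close>)
  then show "greedy_invariant q (greedy_step q (sel st) st)"
    by (simp add: st'_def)
qed

theorem theorem1:
  fixes q :: "'p query" and sel :: "'p greedy_state \<Rightarrow> 'p solution"
  assumes "persistent_query q"
    and "greedy_selection q sel"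
  shows "\<exists>st. greedy q sel = Some st \<and>
           sched st \<in> feasible_schedules q \<and>
           (\<Sum>k=1..num_exec q. yval st k) = solutions_used q (sched st) \<and>
           (\<Sum>k=1..num_exec q. yval st k) = Min (solutions_used q ` feasible_schedules q)"
proof -
  let ?N = "num_exec q"
  note step = greedy_invariant_step[OF assms]
  have "\<exists>st. greedy q sel = Some st"
    unfolding greedy_def
  proof (rule measure_while_option_Some
      [where P = "greedy_invariant q" and f = "\<lambda>st. ?N + 1 - pos st"])
    fix st assume st: "greedy_invariant q st" "pos st \<le> ?N"
    show "greedy_invariant q (greedy_step q (sel st) st) \<and>
        ?N + 1 - pos (greedy_step q (sel st) st) < ?N + 1 - pos st"
      using step[OF st] st(2) by auto
  qed (rule greedy_invariant_init[OF assms(1)])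
  then obtain st where st: "greedy q sel = Some st" by blast
  have inv: "greedy_invariant q st"
    by (rule while_option_rule[OF _ st[unfolded greedy_def]])
      (use step greedy_invariant_init[OF assms(1)] in auto)
  have "\<not> pos st \<le> ?N"
    using while_option_stop[OF st[unfolded greedy_def]] .
  \<comment> \<open>The invariant bounds \<open>pos st\<close> by \<open>?N + 1\<close>, so the loop
    cannot overshoot; at this value its last conjunct is exactly the lower bound on every feasible
    schedule.\<close>
  with inv have pos: "pos st = ?N + 1" by (auto simp: greedy_invariant_def)
  note inv' = inv[unfolded greedy_invariant_def pos]
  have feas: "sched st \<in> feasible_schedules q"
    unfolding feasible_schedules_def
  proof (rule PiE_I)
    fix k assume "k \<in> {1..?N}"
    then show "sched st k \<in> {c \<in> solutions q. valid_at q k c}" using inv' by auto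
  next
    fix k assume "k \<notin> {1..?N}"
    then show "sched st k = undefined" using inv' by auto
  qed
  have used: "(\<Sum>k=1..?N. yval st k) = solutions_used q (sched st)"
    unfolding solutions_used_def using inv' by (intro sum.cong) auto
  have "(\<Sum>k=1..?N. yval st k) \<le> solutions_used q \<sigma>" if "\<sigma> \<in> feasible_schedules q" for \<sigma>
    using inv' that unfolding solutions_used_def by (auto simp: min_def)
  with used feas finite_feasible_schedules[OF assms(1)]
  have "Min (solutions_used q ` feasible_schedules q) = (\<Sum>k=1..?N. yval st k)"
    by (intro Min_eqI) auto
  with st feas used show ?thesis by metis
qed

end
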